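(* Let $\mathcal{H}$ be an infinite dimensional Hilbert space, let $A:\mathcal{D}(A)\subseteq\mathcal{H}\to\mathcal{H}$ be a densely defined linear operator, let $\{g_n\}_{n\in\mathbb{N}}\subset\mathcal{H}$ be a weak $A$-frame for $\mathcal{H}$ and let $\{t_n\}_{n\in\mathbb{N}}\subset\mathcal{H}$ be a Bessel sequence of $\mathcal{H}$ which is a weak $A$-dual of $\{g_n\}$. Then $$A^*u=\sum_{n=1}^\infty\langle u|g_n\rangle\,t_n\qquad\text{for all }u\in\mathcal{D}(A^* ),$$ where the series converges in the norm of $\mathcal{H}$.
   Context: $\mathcal{H}$ is a complex Hilbert space with inner product $\langle\cdot|\cdot\rangle$ (linear in the first argument) and norm $\|\cdot\|$. $A^*$ denotes the adjoint of the densely defined operator $A$, with domain $\mathcal{D}(A^* )$. A sequence $\{g_n\}\subset\mathcal{H}$ is a weak $A$-frame for $\mathcal{H}$ if there is $\alpha>0$ such that $\alpha\|A^*f\|^2\le\sum_{n=1}^\infty|\langle f|g_n\rangle|^2<\infty$ for every $f\in\mathcal{D}(A^* )$. A sequence $\{t_n\}\subset\mathcal{H}$ is a weak $A$-dual of $\{g_n\}$ if $\langle Ah|u\rangle=\sum_{n=1}^\infty\langle h|t_n\rangle\langle g_n|u\rangle$ for all $h\in\mathcal{D}(A)$, $u\in\mathcal{D}(A^* )$. A sequence $\{t_n\}\subset\mathcal{H}$ is a Bessel sequence of $\mathcal{H}$ if there is $\beta>0$ with $\sum_{n=1}^\infty|\langle f|t_n\rangle|^2\le\beta\|f\|^2$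 for all $f\in\mathcal{H}$. *)

theory Defs
  imports "HOL-Analysis.Analysis"
begin

section \<open>Complex Hilbert spaces\<close>

class complex_vector = real_vector +
  fixes scaleC :: "complex \<Rightarrow> 'a \<Rightarrow> 'a"
  assumes scaleC_add_right: "scaleC a (x + y) = scaleC a x + scaleC a y"
    and scaleC_add_left: "scaleC (a + b) x = scaleC a x + scaleC b x"
    and scaleC_scaleC: "scaleC a (scaleC b x) = scaleC (a * b) x"
    and scaleC_one: "scaleC 1 x = x"
    and scaleR_scaleC: "scaleR r x = scaleC (complex_of_real r) x"

global_interpretation complex_vector: vector_space "scaleC :: complex \<Rightarrow> 'a \<Rightarrow> 'a :: complex_vector"
  by unfold_locales
    (simp_all add: scaleC_add_right scaleC_add_left scaleC_scaleC scaleC_one)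

text \<open>The inner product is linear in the first argument.\<close>

class complex_inner = complex_vector + real_normed_vector +
  fixes cinner :: "'a \<Rightarrow> 'a \<Rightarrow> complex"
  assumes cinner_commute: "cinner x y = cnj (cinner y x)"
    and cinner_add_left: "cinner (x + y) z = cinner x z + cinner y z"
    and cinner_scaleC_left: "cinner (scaleC a x) y = a * cinner x y"
    and cinner_ge_zero: "0 \<le> Re (cinner x x)"
    and cinner_eq_zero_iff: "cinner x x = 0 \<longleftrightarrow> x = 0"
    and norm_eq_sqrt_cinner: "norm x = sqrt (Re (cinner x x))"

class chilbert_space = complex_inner + complete_space

instantiation complex :: chilbert_space
begin

definition scaleC_complex :: "complex \<Rightarrow> complex \<Rightarrow> complex" where
  "scaleC_complex a x = a * x"

definition cinner_complex :: "complex \<Rightarrow> complex \<Rightarrow> complex" where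
  "cinner_complex x y = x * cnj y"

instance
proof
  fix x :: complex
  show "0 \<le> Re (cinner x x)" "norm x = sqrt (Re (cinner x x))"
    by (simp_all add: cinner_complex_def cmod_power2[symmetric] flip: power2_eq_square)
qed (simp_all add: scaleC_complex_def cinner_complex_def scaleR_conv_of_real algebra_simps)

end

definition infinite_dimensional :: "'a::complex_vector itself \<Rightarrow> bool" where
  "infinite_dimensional _ \<longleftrightarrow> \<not> (\<exists>B :: 'a set. finite B \<and> complex_vector.span B = UNIV)"


section \<open>Densely defined operators and adjoints\<close>

text \<open>An unbounded operator is a pair of a domain \<open>D\<close> and a total function \<open>A\<close>, whose
  values outside \<open>D\<close> are irrelevant.\<close>

definition densely_defined_operator :: "'a::complex_inner set \<Rightarrow> ('a \<Rightarrow> 'a) \<Rightarrow> bool" where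
  "densely_defined_operator D A \<longleftrightarrow>
     complex_vector.subspace D \<and> closure D = UNIV \<and>
     (\<forall>x\<in>D. \<forall>y\<in>D. A (x + y) = A x + A y) \<and>
     (\<forall>c. \<forall>x\<in>D. A (scaleC c x) = scaleC c (A x))"

definition adjoint_domain :: "'a::complex_inner set \<Rightarrow> ('a \<Rightarrow> 'a) \<Rightarrow> 'a set" where
  "adjoint_domain D A = {u. \<exists>v. \<forall>h\<in>D. cinner (A h) u = cinner h v}"

text \<open>The adjoint is determined on its domain when \<open>D\<close> is dense; see
  \<open>op_adjoint_eqI\<close> below.\<close>

definition op_adjoint :: "'a::complex_inner set \<Rightarrow> ('a \<Rightarrow> 'a) \<Rightarrow> 'a \<Rightarrow> 'a" where
  "op_adjoint D A u = (THE v. \<forall>h\<in>D. cinner (A h) u = cinner h v)"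

lemma cinner_diff_left:
  "cinner (x - y) z = cinner x z - cinner y (z::'a::complex_inner)"
  using cinner_add_left[of "x - y" y z] by simp

lemma cinner_diff_right:
  "cinner x (y - z) = cinner x y - cinner x (z::'a::complex_inner)"
  by (metis cinner_commute cinner_diff_left complex_cnj_diff)

lemma norm_diff_square_orthogonal:
  assumes "cinner h w = 0"
  shows "(norm (h - w))\<^sup>2 = (norm h)\<^sup>2 + (norm (w::'a::complex_inner))\<^sup>2"
proof -
  have "cinner w h = 0"
    using assms cinner_commute[of w h] by simp
  then show ?thesis
    using assms
    by (simp add: norm_eq_sqrt_cinner cinner_ge_zero cinner_diff_left cinner_diff_right)
qed

lemma op_adjoint_eqI:
  assumes dense: "densely_defined_operator D A"
    and v: "\<And>h. h \<in> D \<Longrightarrow> cinner (A h) u = cinner h v"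
  shows "op_adjoint D A u = v"
  unfolding op_adjoint_def
proof (rule the_equality)
  fix v' assume v': "\<forall>h\<in>D. cinner (A h) u = cinner h v'"
  define w where "w = v' - v"
  have orth: "cinner h w = 0" if "h \<in> D" for h
    using that v v' by (simp add: w_def cinner_diff_right)
  show "v' = v"
  proof (rule ccontr)
    assume "v' \<noteq> v"
    then have "norm w > 0" by (simp add: w_def)
    moreover have "w \<in> closure D"
      using dense by (simp add: densely_defined_operator_def)
    ultimately obtain h where h: "h \<in> D" "dist h w < norm w"
      unfolding closure_approachable by blast
    have "(norm w)\<^sup>2 \<le> (norm (h - w))\<^sup>2"
      using norm_diff_square_orthogonal[OF orth[OF h(1)]] by simp
    then have "norm w \<le> norm (h - w)"
      by (rule power2_le_imp_le) simp
    with h(2) show False by (simp add: dist_norm)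
  qed
qed (use v in blast)


section \<open>Frames\<close>

definition weak_A_frame ::
    "'a::complex_inner set \<Rightarrow> ('a \<Rightarrow> 'a) \<Rightarrow> (nat \<Rightarrow> 'a) \<Rightarrow> bool" where
  "weak_A_frame D A g \<longleftrightarrow>
     (\<exists>\<alpha>>0. \<forall>f\<in>adjoint_domain D A.
        summable (\<lambda>n. (cmod (cinner f (g n)))\<^sup>2) \<and>
        \<alpha> * (norm (op_adjoint D A f))\<^sup>2 \<le> (\<Sum>n. (cmod (cinner f (g n)))\<^sup>2))"

definition weak_A_dual ::
    "'a::complex_inner set \<Rightarrow> ('a \<Rightarrow> 'a) \<Rightarrow> (nat \<Rightarrow> 'a) \<Rightarrow> (nat \<Rightarrow> 'a) \<Rightarrow> bool" where
  "weak_A_dual D A g t \<longleftrightarrow>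
     (\<forall>h\<in>D. \<forall>u\<in>adjoint_domain D A.
        (\<lambda>n. cinner h (t n) * cinner (g n) u) sums cinner (A h) u)"

definition bessel_sequence :: "(nat \<Rightarrow> 'a::complex_inner) \<Rightarrow> bool" where
  "bessel_sequence t \<longleftrightarrow>
     (\<exists>\<beta>>0. \<forall>f.
        summable (\<lambda>n. (cmod (cinner f (t n)))\<^sup>2) \<and>
        (\<Sum>n. (cmod (cinner f (t n)))\<^sup>2) \<le> \<beta> * (norm f)\<^sup>2)"

end

theory Submission
  imports Defs
begin

text \<open>By duality, a Bessel bound for \<open>t\<close> bounds the norm of every finite combination of the
  \<open>t n\<close> by the \<open>\<ell>\<^sup>2\<close>-norm of its coefficients, so the frame series has Cauchy partial sums.
  Pairing its limit with \<open>h\<close> in the domain gives \<open>cinner (A h) u\<close> by the weak dual property, and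
  density identifies the limit with the adjoint.\<close>

lemma cinner_scaleC_right:
  "cinner x (scaleC a y) = cnj a * cinner x (y::'a::complex_inner)"
  by (metis cinner_commute cinner_scaleC_left complex_cnj_mult)

lemma cinner_zero_left [simp]: "cinner 0 (y::'a::complex_inner) = 0"
  using cinner_diff_left[of 0 0 y] by simp

lemma cinner_zero_right [simp]: "cinner x (0::'a::complex_inner) = 0"
  using cinner_diff_right[of x 0 0] by simp

lemma cinner_add_right:
  "cinner x (y + z) = cinner x y + cinner x (z::'a::complex_inner)"
  using cinner_diff_right[of x "y + z" z] by simp

lemma cinner_sum_left:
  "cinner (\<Sum>n\<in>F. f n) (y::'a::complex_inner) = (\<Sum>n\<in>F. cinner (f n) y)"
  by (induction F rule: infinite_finite_induct) (simp_all add: cinner_add_left)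

lemma cinner_sum_right:
  "cinner x (\<Sum>n\<in>F. f n :: 'a::complex_inner) = (\<Sum>n\<in>F. cinner x (f n))"
  by (induction F rule: infinite_finite_induct) (simp_all add: cinner_add_right)

lemma cinner_self: "cinner x x = complex_of_real ((norm (x::'a::complex_inner))\<^sup>2)"
proof (rule complex_eqI)
  have "cnj (cinner x x) = cinner x x"
    using cinner_commute[of x x] by simp
  then show "Im (cinner x x) = Im (complex_of_real ((norm x)\<^sup>2))"
    by (simp add: complex_eq_iff)
qed (simp add: norm_eq_sqrt_cinner cinner_ge_zero)

text \<open>The norm axioms give homogeneity for real scalars only; the complex case is recovered
  from the inner product through \<open>cinner_self\<close>.\<close>

lemma norm_scaleC: "norm (scaleC a x) = cmod a * norm (x::'a::complex_inner)"
proof -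
  have "complex_of_real ((norm (scaleC a x))\<^sup>2) = (a * cnj a) * complex_of_real ((norm x)\<^sup>2)"
    unfolding cinner_self[symmetric] by (simp add: cinner_scaleC_left cinner_scaleC_right)
  also have "\<dots> = complex_of_real ((cmod a * norm x)\<^sup>2)"
    by (simp add: power_mult_distrib flip: complex_norm_square)
  finally have "(norm (scaleC a x))\<^sup>2 = (cmod a * norm x)\<^sup>2"
    by (simp only: of_real_eq_iff)
  then show ?thesis by simp
qed

text \<open>Project \<open>x\<close> onto the line spanned by \<open>y\<close>: by Pythagoras the
  projection \<open>z\<close> is no longer than \<open>x\<close>, and its length times that of
  \<open>y\<close> is \<open>cmod (cinner x y)\<close>.\<close>

lemma cinner_Cauchy_Schwarz:
  "cmod (cinner x y) \<le> norm x * norm (y::'a::complex_inner)"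
proof (cases "y = 0")
  case False
  define c where "c = cinner x y / cinner y y"
  define z where "z = scaleC c y"
  have "cinner (x - z) y = 0"
    using False by (simp add: z_def c_def cinner_diff_left cinner_scaleC_left cinner_eq_zero_iff)
  \<comment> \<open>The sign fits \<open>norm_diff_square_orthogonal\<close>, whose difference
    \<open>(x - z) - (- z)\<close> is then \<open>x\<close>.\<close>
  then have "cinner (x - z) (- z) = 0"
    using cinner_diff_right[of "x - z" 0 z] by (simp add: z_def cinner_scaleC_right)
  from norm_diff_square_orthogonal[OF this] have "(norm z)\<^sup>2 \<le> (norm x)\<^sup>2"
    by simp
  then have "norm z \<le> norm x"
    by (rule power2_le_imp_le) simp
  moreover have "norm z * norm y = cmod (cinner x y)"
    using False
    by (simp add: z_def c_def norm_scaleC cinner_self norm_divide norm_mult power2_eq_square)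
  ultimately show ?thesis
    by (metis mult_right_mono norm_ge_zero)
qed simp

text \<open>Conjugate-linearity in the second argument is still linearity over the reals, which is
  enough to move \<open>cinner x\<close> inside a convergent series.\<close>

lemma bounded_linear_cinner_right:
  "bounded_linear (\<lambda>y. cinner x (y::'a::complex_inner))"
  by (rule bounded_linear_intro[where K = "norm x"])
    (use cinner_Cauchy_Schwarz[of x] in
      \<open>simp_all add: cinner_add_right scaleR_scaleC[where 'a = 'a] cinner_scaleC_right mult.commute
        flip: scaleR_conv_of_real\<close>)

text \<open>Synthesis is the adjoint of the analysis map sending \<open>f\<close> to the
  coefficients \<open>cinner f (t n)\<close>, so it inherits the same bound. Concretely, the
  combination \<open>x\<close> is paired with itself and the Bessel inequality is applied at
  \<open>x\<close>.\<close>

lemma bessel_synthesis_bound: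
  fixes t :: "nat \<Rightarrow> 'a::complex_inner"
  assumes summ: "\<And>f. summable (\<lambda>n. (cmod (cinner f (t n)))\<^sup>2)"
    and bound: "\<And>f. (\<Sum>n. (cmod (cinner f (t n)))\<^sup>2) \<le> \<beta> * (norm f)\<^sup>2"
    and "\<beta> \<ge> 0" and F: "finite F"
  shows "(norm (\<Sum>n\<in>F. scaleC (c n) (t n)))\<^sup>2 \<le> \<beta> * (\<Sum>n\<in>F. (cmod (c n))\<^sup>2)"
proof -
  define x where "x = (\<Sum>n\<in>F. scaleC (c n) (t n))"
  define S where "S = (\<Sum>n\<in>F. (cmod (c n))\<^sup>2)"
  have S0: "S \<ge> 0" by (simp add: S_def sum_nonneg)
  \<comment> \<open>Only the second \<open>x\<close> is expanded, so that the analysis coefficients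
    of \<open>x\<close> appear.\<close>
  have "cinner x x = (\<Sum>n\<in>F. cnj (c n) * cinner x (t n))"
    by (subst (2) x_def) (simp add: cinner_sum_right cinner_scaleC_right)
  moreover have "cmod (cinner x x) = (norm x)\<^sup>2"
    by (simp add: cinner_self norm_power)
  ultimately have "(norm x)\<^sup>2 = cmod (\<Sum>n\<in>F. cnj (c n) * cinner x (t n))"
    by simp
  also have "\<dots> \<le> (\<Sum>n\<in>F. cmod (c n) * cmod (cinner x (t n)))"
    by (rule order.trans[OF norm_sum]) (simp add: norm_mult)
  finally have "((norm x)\<^sup>2)\<^sup>2 \<le> (\<Sum>n\<in>F. cmod (c n) * cmod (cinner x (t n)))\<^sup>2"
    by (rule power_mono) simp
  also have "\<dots> \<le> S * (\<Sum>n\<in>F. (cmod (cinner x (t n)))\<^sup>2)"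
    unfolding S_def by (rule Cauchy_Schwarz_ineq_sum)
  also have "\<dots> \<le> S * (\<beta> * (norm x)\<^sup>2)"
    using sum_le_suminf[OF summ F, of x] bound[of x] S0
    by (intro mult_left_mono) auto
  finally have *: "(norm x)\<^sup>2 * (norm x)\<^sup>2 \<le> (\<beta> * S) * (norm x)\<^sup>2"
    by (simp add: power2_eq_square mult_ac)
  \<comment> \<open>Cancelling the common factor \<open>(norm x)\<^sup>2\<close> requires
    \<open>x\<close> to be nonzero.\<close>
  show ?thesis
  proof (cases "x = 0")
    case True
    then show ?thesis
      using S0 \<open>\<beta> \<ge> 0\<close> by (simp add: x_def S_def)
  next
    case False
    then show ?thesis
      using mult_right_le_imp_le[OF *] by (simp add: x_def S_def)
  qed
qed

lemma bessel_synthesis_summable: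
  fixes t :: "nat \<Rightarrow> 'a::chilbert_space"
  assumes "bessel_sequence t" and c: "summable (\<lambda>n. (cmod (c n))\<^sup>2)"
  shows "summable (\<lambda>n. scaleC (c n) (t n))"
proof -
  from \<open>bessel_sequence t\<close> obtain \<beta> where "\<beta> > 0"
    and summ: "\<And>f. summable (\<lambda>n. (cmod (cinner f (t n)))\<^sup>2)"
    and bound: "\<And>f. (\<Sum>n. (cmod (cinner f (t n)))\<^sup>2) \<le> \<beta> * (norm f)\<^sup>2"
    unfolding bessel_sequence_def by blast
  have "Cauchy (\<lambda>n. \<Sum>k<n. scaleC (c k) (t k))"
    unfolding Cauchy_altdef
  proof (intro allI impI)
    fix e :: real assume "e > 0"
    \<comment> \<open>This tolerance for the coefficient tails turns into \<open>e\<^sup>2\<close>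
      after multiplication by the Bessel bound.\<close>
    then have "e\<^sup>2 / \<beta> > 0" using \<open>\<beta> > 0\<close> by simp
    then obtain N where N: "\<And>m n. m \<ge> N \<Longrightarrow> norm (\<Sum>k=m..<n. (cmod (c k))\<^sup>2) < e\<^sup>2 / \<beta>"
      using c unfolding summable_Cauchy by blast
    have "dist (\<Sum>k<m. scaleC (c k) (t k)) (\<Sum>k<n. scaleC (c k) (t k)) < e"
      if "m \<ge> N" "m < n" for m n
    proof -
      have diff: "(\<Sum>k<n. scaleC (c k) (t k)) - (\<Sum>k<m. scaleC (c k) (t k))
          = (\<Sum>k=m..<n. scaleC (c k) (t k))"
        using sum_diff_nat_ivl[of 0 m n "\<lambda>k. scaleC (c k) (t k)"] that
        by (simp add: atLeast0LessThan)
      have "(norm (\<Sum>k=m..<n. scaleC (c k) (t k)))\<^sup>2 \<le> \<beta> * (\<Sum>k=m..<n. (cmod (c k))\<^sup>2)"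
        using \<open>\<beta> > 0\<close> by (intro bessel_synthesis_bound summ bound) auto
      also have "\<dots> < e\<^sup>2"
        using N[OF \<open>m \<ge> N\<close>, of n] \<open>\<beta> > 0\<close> by (simp add: field_simps sum_nonneg)
      finally have "norm (\<Sum>k=m..<n. scaleC (c k) (t k)) < e"
        by (rule power2_less_imp_less) (use \<open>e > 0\<close> in simp)
      then show ?thesis
        by (simp add: dist_norm norm_minus_commute[of "sum _ {..<m}"] diff)
    qed
    then show "\<exists>M. \<forall>m\<ge>M. \<forall>n>m.
        dist (\<Sum>k<m. scaleC (c k) (t k)) (\<Sum>k<n. scaleC (c k) (t k)) < e"
      by blast
  qed
  then show ?thesis
    by (simp add: Cauchy_convergent_iff summable_iff_convergent)
qed

theorem mainTheorem3:
  fixes D :: "'a::chilbert_space set"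
    and A :: "'a \<Rightarrow> 'a"
    and g t :: "nat \<Rightarrow> 'a"
  assumes "infinite_dimensional TYPE('a)"
    and "densely_defined_operator D A"
    and "weak_A_frame D A g"
    and "bessel_sequence t"
    and "weak_A_dual D A g t"
  shows "\<forall>u\<in>adjoint_domain D A. (\<lambda>n. scaleC (cinner u (g n)) (t n)) sums op_adjoint D A u"
proof
  fix u assume u: "u \<in> adjoint_domain D A"
  define v where "v = (\<Sum>n. scaleC (cinner u (g n)) (t n))"
  \<comment> \<open>Finiteness of the frame sum at \<open>u\<close> makes the coefficients square
    summable.\<close>
  have "summable (\<lambda>n. (cmod (cinner u (g n)))\<^sup>2)"
    using \<open>weak_A_frame D A g\<close> u unfolding weak_A_frame_def by blast
  then have v: "(\<lambda>n. scaleC (cinner u (g n)) (t n)) sums v"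
    unfolding v_def by (intro summable_sums bessel_synthesis_summable \<open>bessel_sequence t\<close>)
  have "cinner (A h) u = cinner h v" if "h \<in> D" for h
  proof (rule sums_unique2)
    show "(\<lambda>n. cinner h (t n) * cinner (g n) u) sums cinner (A h) u"
      using \<open>weak_A_dual D A g t\<close> that u unfolding weak_A_dual_def by blast
    \<comment> \<open>The coefficient leaves the second argument conjugated, and
      \<open>cnj (cinner u (g n))\<close> is \<open>cinner (g n) u\<close>; the terms thus match
      those of the weak dual series.\<close>
    have "cinner h (scaleC (cinner u (g n)) (t n)) = cinner h (t n) * cinner (g n) u" for n
      by (simp add: cinner_scaleC_right flip: cinner_commute)
    then show "(\<lambda>n. cinner h (t n) * cinner (g n) u) sums cinner h v"
      using bounded_linear.sums[OF bounded_linear_cinner_right v, of h] by simp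
  qed
  then have "op_adjoint D A u = v"
    by (intro op_adjoint_eqI \<open>densely_defined_operator D A\<close>)
  with v show "(\<lambda>n. scaleC (cinner u (g n)) (t n)) sums op_adjoint D A u"
    by simp
qed

end
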